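(* (a) Let $(X,d)$ be a $Lip_2$ metric space. Then $$\partial X^{2} = \{ \partial^{+}\mathcal{F} \mid \mathcal{F}\in Lipflow(X,d)\}$$ is a uniform refinement of $X$ (equipped with its metric topology and the uniformity filter $\Omega_d$ of the distance $d$). (b) Moreover, let $(X,d)$ and $(X',d')$ be $Lip_2$ metric spaces and let $f: X\to X'$ be a surjective bi-Lipschitz function. Then $f$ is uniformly topologically derivable with respect to the uniform refinements $\partial X^2 = \{\partial^{+}\mathcal{F} \mid \mathcal{F}\in Lipflow(X,d)\}$ and $\partial (X')^2=\{\partial^{+}\mathcal{F}' \mid \mathcal{F}'\in Lipflow(X',d')\}$ given by (a).
   Context: **Filters.** Let $(Y,\tau)$ be a topological space ($\tau$ is the collection of open sets). A filter in $(Y,\tau)$ is a function $\nu:\tau\to\{0,1\}$ such that $\nu(Y)=1$; $A\subset B$ implies $\nu(A)\le\nu(B)$ for $A,B\in\tau$; and $\nu(A\cup B)+\nu(A\cap B)\ge \nu(A)+\nu(B)$ for all $A,B\in\tau$. We write $\nu\ge\nu'$ if $\nu(D)\ge\nu'(D)$ for all $D\in\tau$. The filter generated by a family of open sets which is directed downwards by inclusion is the one with $\nu(D)=1$ if and only if $D\in\tau$ contains a member of the family. If $g:Y\to Z$ is continuous and $\nu$ is a filter in $Y$, then $g*\nu$ is the filter in $Z$ given by $(g*\nu)(A)=\nu(g^{-1}(A))$ for $A$ open in $Z$. **Uniform refinements.** For a metric space $(X,d)$, give $X^2=X\times X$ the product topology $\tau^2$. The uniformity filter $\Omega_d$ of $d$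 is the filter in $(X^2,\tau^2)$ with $\Omega_d(U)=1$ iff there is $s>0$ with $\{(x,y)\in X^2\mid d(x,y)<s\}\subset U$. For $A,B\subset X^2$ let $A\circ B=\{(x,z)\mid \exists y\in X,\ (x,y)\in A,\ (y,z)\in B\}$, and let $\sigma(x,y)=(y,x)$. A uniform refinement of $(X,d)$ is a set $\partial\Omega$ of filters in $(X^2,\tau^2)$ such that, for every $\nu\in\partial\Omega$: $\nu\ge\Omega_d$; for every $D$ with $\nu(D)=1$ there is $E$ with $\nu(E)=1$ and $E\circ E\subset D$; and $\sigma*\nu\in\partial\Omega$. **Uniform topological derivability.** Let $X$, $X'$ carry uniform refinements $\partial\Omega$, $\partial\Omega'$. A uniformly continuous function $f:X\to X'$ is uniformly topologically derivable with respect to them if for every $\nu\in\partial\Omega$ we have $f^2*\nu\in\partial\Omega'$, where $f^2:X^2\to (X')^2$, $f^2(x,y)=(f(x),f(y))$. **Flows and $Lip_2$ spaces.** Let $(X,d)$ be a locally compact length metric space. $Lipflow(X,d)$ is the collection of all maps (flows) $\mathcal{F}:[a,b]\times X\to X$, where $a<0<b$, such that: (a) $\mathcal{F}(0,x)=x$ for all $x\in X$; (b) the family of functions $\{\mathcal{F}(\cdot,x)\mid x\in X\}$ is equicontinuous; (c) there is a function $M:[a,b]\to(0,+\infty)$, continuous at $0$, such that for any $t\in[a,b]$ $$\limsup_{\varepsilon\to0}\ \sup\left\{\frac{d(\mathcal{F}(t,x),\mathcal{F}(t,y))}{d(x,y)}\ \Big|\ 0<d(x,y)<\varepsilon\right\}\le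 M(t),$$ $$\liminf_{\varepsilon\to0}\ \inf\left\{\frac{d(\mathcal{F}(t,x),\mathcal{F}(t,y))}{d(x,y)}\ \Big|\ 0<d(x,y)<\varepsilon\right\}\ge \frac1{M(t)};$$ (d) whenever $s,t,s+t\in[a,b]$, $\mathcal{F}(s+t,x)=\mathcal{F}(s,\mathcal{F}(t,x))$ for any $x\in X$; (e) there is a constant $C>0$ such that for all sufficiently small $\varepsilon',\varepsilon''>0$ and $\mu',\mu''\in(0,1)$ and all $x,y,z\in X$: if $(y,z)\in V^{+}(\mathcal{F},\varepsilon',\mu')$ and $(y,x)\in V^{+}(\bar{\mathcal{F}},\varepsilon'',\mu'')$, then $d(x,y)+d(y,z)\le C\,d(x,z)$. Here $\bar{\mathcal{F}}(s,x)=\mathcal{F}(-s,x)$ and, for $\varepsilon>0$, $\mu\in(0,1)$, $$V^{+}(\mathcal{F},\varepsilon,\mu)=\{(x,y)\in X^2\mid d(y,\mathcal{F}([0,\varepsilon],x))<\mu\, d(x,y)\},$$ where $\mathcal{F}([0,\varepsilon],x)$ is the set of all $\mathcal{F}(s,x)$ with $s\in[0,\varepsilon]$ in the time domain of $\mathcal{F}$, and $d(y,S)$ is the distance from a point to a set. The filter $\partial^{+}\mathcal{F}$ in $X\times X$ is the one generated by the open sets $V^{+}(\mathcal{F},\varepsilon,\mu)$, $\varepsilon>0$, $\mu\in(0,1)$. A locally compact length metric space $(X,d)$ is called $Lip_2$ (of second kind) if $Lipflow(X,d)$ is non-empty. *)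

theory Defs
  imports "HOL-Analysis.Analysis"
begin

section \<open>Filters of open sets\<close>

text \<open>
  A filter is a \<open>{0,1}\<close>-valued function on the collection of open sets. Its domain is enforced by
  extensionality, so that equality of filters is equality of functions on open sets. As the
  conditions below allow it, the value on the empty set may be \<open>1\<close>.
\<close>

type_synonym 'a ofilter = "'a set \<Rightarrow> nat"

definition is_ofilter :: "'a::topological_space ofilter \<Rightarrow> bool" where
  "is_ofilter \<nu> \<longleftrightarrow>
     \<nu> \<in> {A. open A} \<rightarrow>\<^sub>E {0, 1} \<and>
     \<nu> UNIV = 1 \<and>
     (\<forall>A B. open A \<longrightarrow> open B \<longrightarrow> A \<subseteq> B \<longrightarrow> \<nu> A \<le> \<nu> B) \<and>
     (\<forall>A B. open A \<longrightarrow> open B \<longrightarrow> \<nu> (A \<union> B) + \<nu> (A \<inter> B) \<ge> \<nu> A + \<nu> B)"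

definition ofilter_ge :: "'a::topological_space ofilter \<Rightarrow> 'a ofilter \<Rightarrow> bool" where
  "ofilter_ge \<nu> \<nu>' \<longleftrightarrow> (\<forall>D. open D \<longrightarrow> \<nu> D \<ge> \<nu>' D)"

definition generated_ofilter :: "'a::topological_space set set \<Rightarrow> 'a ofilter" where
  "generated_ofilter \<B> = (\<lambda>D\<in>{D. open D}. if \<exists>B\<in>\<B>. B \<subseteq> D then 1 else 0)"

definition push_ofilter ::
  "('a::topological_space \<Rightarrow> 'b::topological_space) \<Rightarrow> 'a ofilter \<Rightarrow> 'b ofilter" where
  "push_ofilter g \<nu> = (\<lambda>A\<in>{A. open A}. \<nu> (g -` A))"

section \<open>Uniform refinements\<close>

definition uniformity_ofilter :: "('a::metric_space \<times> 'a) ofilter" where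
  "uniformity_ofilter =
     (\<lambda>U\<in>{U. open U}. if \<exists>s>0. {(x, y). dist x y < s} \<subseteq> U then 1 else 0)"

definition uniform_refinement :: "('a::metric_space \<times> 'a) ofilter set \<Rightarrow> bool" where
  "uniform_refinement R \<longleftrightarrow>
     (\<forall>\<nu>\<in>R. is_ofilter \<nu> \<and>
        ofilter_ge \<nu> uniformity_ofilter \<and>
        (\<forall>D. open D \<and> \<nu> D = 1 \<longrightarrow> (\<exists>E. open E \<and> \<nu> E = 1 \<and> E O E \<subseteq> D)) \<and>
        push_ofilter prod.swap \<nu> \<in> R)"

definition uniformly_topologically_derivable ::
  "('a::metric_space \<times> 'a) ofilter set \<Rightarrow> ('b::metric_space \<times> 'b) ofilter set \<Rightarrow> ('a \<Rightarrow> 'b) \<Rightarrow> bool"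
where
  "uniformly_topologically_derivable R R' f \<longleftrightarrow>
     uniform_refinement R \<and> uniform_refinement R' \<and>
     uniformly_continuous_on UNIV f \<and>
     (\<forall>\<nu>\<in>R. push_ofilter (map_prod f f) \<nu> \<in> R')"

section \<open>Length metric spaces\<close>

definition curve_length :: "(real \<Rightarrow> 'a::metric_space) \<Rightarrow> ennreal" where
  "curve_length g =
     (SUP (n, t) \<in> {(n, t). mono_on {..n} t \<and> t 0 = 0 \<and> t n = 1}.
        \<Sum>i<n. ennreal (dist (g (t i)) (g (t (Suc i)))))"

text \<open>
  The infimum of the empty set is \<open>\<infinity>\<close>, so the condition forces any two points to be joined by a
  curve of finite length.
\<close>

definition length_metric_space :: "'a::metric_space itself \<Rightarrow> bool" where
  "length_metric_space _ \<longleftrightarrow>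
     (\<forall>x y :: 'a. ennreal (dist x y) =
        (INF g \<in> {g. path g \<and> pathstart g = x \<and> pathfinish g = y}. curve_length g))"

section \<open>Flows\<close>

text \<open>
  \<open>Flow a b F\<close> stands for the map \<open>(t, x) \<mapsto> F t x\<close> on \<open>[a, b] \<times> X\<close>. The values of \<open>F\<close> at times
  outside \<open>[a, b]\<close> carry no meaning and are not used below.
\<close>

datatype 'a flow = Flow (start_time: real) (end_time: real) (flow_map: "real \<Rightarrow> 'a \<Rightarrow> 'a")

definition time_domain :: "'a flow \<Rightarrow> real set" where
  "time_domain \<F> = {start_time \<F>..end_time \<F>}"

definition reverse_flow :: "'a flow \<Rightarrow> 'a flow" where
  "reverse_flow \<F> = Flow (- end_time \<F>) (- start_time \<F>) (\<lambda>s. flow_map \<F> (- s))"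

definition Vplus :: "'a::metric_space flow \<Rightarrow> real \<Rightarrow> real \<Rightarrow> ('a \<times> 'a) set" where
  "Vplus \<F> \<epsilon> \<mu> =
     {(x, y). infdist y ((\<lambda>s. flow_map \<F> s x) ` ({0..\<epsilon>} \<inter> time_domain \<F>)) < \<mu> * dist x y}"

definition flow_ofilter :: "'a::metric_space flow \<Rightarrow> ('a \<times> 'a) ofilter" where
  "flow_ofilter \<F> = generated_ofilter {Vplus \<F> \<epsilon> \<mu> | \<epsilon> \<mu>. \<epsilon> > 0 \<and> 0 < \<mu> \<and> \<mu> < 1}"

definition equicontinuous_on ::
  "'a::metric_space set \<Rightarrow> ('a \<Rightarrow> 'b::metric_space) set \<Rightarrow> bool" where
  "equicontinuous_on S \<G> \<longleftrightarrow>
     (\<forall>t\<in>S. \<forall>e>0. \<exists>\<delta>>0. \<forall>g\<in>\<G>. \<forall>s\<in>S. dist s t < \<delta> \<longrightarrow> dist (g s) (g t) < e)"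

text \<open>
  In the last condition ``sufficiently small'' applies to all of \<open>\<epsilon>'\<close>, \<open>\<epsilon>''\<close>, \<open>\<mu>'\<close>, \<open>\<mu>''\<close>, with
  thresholds independent of the points. The suprema and infima of difference quotients are taken
  in the extended reals.
\<close>

definition Lipflow :: "'a::metric_space flow set" where
  "Lipflow = {\<F>.
     start_time \<F> < 0 \<and> 0 < end_time \<F> \<and>
     (\<forall>x. flow_map \<F> 0 x = x) \<and>
     equicontinuous_on (time_domain \<F>) {\<lambda>t. flow_map \<F> t x | x. True} \<and>
     (\<exists>M :: real \<Rightarrow> real.
        (\<forall>t\<in>time_domain \<F>. M t > 0) \<and>
        continuous (at 0 within time_domain \<F>) M \<and>
        (\<forall>t\<in>time_domain \<F>.
           Limsup (at_right (0::real)) (\<lambda>\<epsilon>. SUP (x, y) \<in> {(x, y). 0 < dist x y \<and> dist x y < \<epsilon>}.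
             ereal (dist (flow_map \<F> t x) (flow_map \<F> t y) / dist x y)) \<le> ereal (M t) \<and>
           Liminf (at_right (0::real)) (\<lambda>\<epsilon>. INF (x, y) \<in> {(x, y). 0 < dist x y \<and> dist x y < \<epsilon>}.
             ereal (dist (flow_map \<F> t x) (flow_map \<F> t y) / dist x y)) \<ge> ereal (1 / M t))) \<and>
     (\<forall>s\<in>time_domain \<F>. \<forall>t\<in>time_domain \<F>. s + t \<in> time_domain \<F> \<longrightarrow>
        (\<forall>x. flow_map \<F> (s + t) x = flow_map \<F> s (flow_map \<F> t x))) \<and>
     (\<exists>C>0. \<exists>\<epsilon>\<^sub>0>0. \<exists>\<mu>\<^sub>0\<in>{0<..<1}.
        \<forall>\<epsilon>'\<in>{0<..<\<epsilon>\<^sub>0}. \<forall>\<epsilon>''\<in>{0<..<\<epsilon>\<^sub>0}. \<forall>\<mu>'\<in>{0<..<\<mu>\<^sub>0}. \<forall>\<mu>''\<in>{0<..<\<mu>\<^sub>0}. \<forall>x y z.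
          (y, z) \<in> Vplus \<F> \<epsilon>' \<mu>' \<and> (y, x) \<in> Vplus (reverse_flow \<F>) \<epsilon>'' \<mu>'' \<longrightarrow>
          dist x y + dist y z \<le> C * dist x z)}"

definition Lip2_space :: "'a::metric_space itself \<Rightarrow> bool" where
  "Lip2_space T \<longleftrightarrow>
     locally_compact_space (euclidean :: 'a topology) \<and>
     length_metric_space T \<and>
     (Lipflow :: 'a flow set) \<noteq> {}"

definition flow_refinement :: "('a::metric_space \<times> 'a) ofilter set" where
  "flow_refinement = {flow_ofilter \<F> | \<F>. \<F> \<in> Lipflow}"

section \<open>Bi-Lipschitz maps\<close>

definition bi_Lipschitz :: "('a::metric_space \<Rightarrow> 'b::metric_space) \<Rightarrow> bool" where
  "bi_Lipschitz f \<longleftrightarrow>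
     (\<exists>L>0. \<forall>x y. dist x y / L \<le> dist (f x) (f y) \<and> dist (f x) (f y) \<le> L * dist x y)"

end

theory Submission
  imports Defs
begin

text \<open>
  A pair \<open>(x, y)\<close> lies in \<open>Vplus \<F> \<epsilon> \<mu>\<close> when \<open>y\<close> is reached from \<open>x\<close> by following the flow for
  a time at most \<open>\<epsilon>\<close>, up to an error \<open>\<mu> * dist x y\<close>. The filter of
  a flow dominates the uniformity because short orbits are uniformly small. The rest of the first
  part, on composition and exchange of coordinates, comes from one estimate: the maps \<open>F t\<close> of a flow share a
  Lipschitz constant \<open>K\<close> for all times \<open>t\<close> near \<open>0\<close> (\<open>flow_short_times\<close>). The hypothesis on the
  flow bounds difference quotients of \<open>F t\<close> only over distances below a scale that may shrink
  uncontrollably as \<open>t\<close> varies. In a length space a bound at any one scale is a global bound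
  (\<open>length_space_Lipschitz\<close>), since nearly shortest curves can be cut into arbitrarily short
  pieces, so the scale disappears and continuity of \<open>M\<close> at \<open>0\<close> makes the constant uniform.

  With \<open>K\<close> at hand, applying \<open>F (- s)\<close> to \<open>y \<approx> F s x\<close> gives \<open>x \<approx> F (- s) y\<close> with error at
  most \<open>K\<close> times larger. Hence swapping coordinates exchanges the cones of a flow and those of its
  time reversal, up to changing \<open>\<mu>\<close> (\<open>Vplus_reverse\<close>, \<open>swap_flow_ofilter\<close>). Similarly, if
  \<open>y \<approx> F s x\<close> and \<open>z \<approx> F t y\<close>, then \<open>z \<approx> F (t + s) x\<close> with an error proportional to
  \<open>\<mu> * (dist x y + dist y z)\<close>. This has to be compared with \<open>dist x z\<close>, which is what the last
  condition on flows is for: \<open>z\<close> lies ahead of \<open>y\<close> and, by the reversal just described, \<open>x\<close> lies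
  behind \<open>y\<close>, so the two distances add up to at most \<open>C * dist x z\<close> (\<open>Vplus_relcomp\<close>).

  For the second part, a surjective bi-Lipschitz map \<open>f\<close> is a bijection, and conjugation by \<open>f\<close> turns
  flows into flows (\<open>conjugate_flow_Lipflow\<close>). It distorts the cones by a factor \<open>L\<^sup>2\<close> in \<open>\<mu>\<close> in
  both directions, which is invisible to the filter, so \<open>f\<close> carries the filter of a flow to the
  filter of the conjugate flow (\<open>push_conjugate_flow_ofilter\<close>).
\<close>

section \<open>Difference quotients at small scales\<close>

text \<open>
  The two bounds on difference quotients in the definition of a flow, in epsilon-delta form. Clearing
  the denominator makes pairs of equal points harmless.
\<close>

definition small_scale_upper :: "('a::metric_space \<Rightarrow> 'b::metric_space) \<Rightarrow> real \<Rightarrow> bool" where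
  "small_scale_upper g c \<longleftrightarrow>
     (\<forall>K>c. \<exists>e>0. \<forall>x y. dist x y < e \<longrightarrow> dist (g x) (g y) \<le> K * dist x y)"

definition small_scale_lower :: "('a::metric_space \<Rightarrow> 'b::metric_space) \<Rightarrow> real \<Rightarrow> bool" where
  "small_scale_lower g c \<longleftrightarrow>
     (\<forall>k<c. \<exists>e>0. \<forall>x y. dist x y < e \<longrightarrow> k * dist x y \<le> dist (g x) (g y))"

text \<open>
  The suprema increase with the scale, so a bound that holds eventually already holds for all
  distances below a single scale.
\<close>

lemma Limsup_quotient_le_iff:
  fixes g :: "'a::metric_space \<Rightarrow> 'b::metric_space"
  shows "Limsup (at_right (0::real)) (\<lambda>\<epsilon>. SUP (x, y) \<in> {(x, y). 0 < dist x y \<and> dist x y < \<epsilon>}.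
           ereal (dist (g x) (g y) / dist x y)) \<le> ereal c \<longleftrightarrow> small_scale_upper g c"
    (is "Limsup _ ?q \<le> _ \<longleftrightarrow> _")
proof
  assume L: "Limsup (at_right 0) ?q \<le> ereal c"
  show "small_scale_upper g c"
    unfolding small_scale_upper_def
  proof (intro allI impI)
    fix K assume "c < K"
    then have "\<forall>\<^sub>F e in at_right 0. ?q e < ereal K"
      using L unfolding Limsup_le_iff by auto
    then obtain b where b: "b > 0" "\<And>e. 0 < e \<Longrightarrow> e < b \<Longrightarrow> ?q e < ereal K"
      unfolding eventually_at_right_field by blast
    have q: "?q (b/2) < ereal K" using b(2)[of "b/2"] b(1) by linarith
    have "dist (g x) (g y) \<le> K * dist x y" if d: "dist x y < b/2" for x y
    proof (cases "x = y")
      case False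
      then have "ereal (dist (g x) (g y) / dist x y) \<le> ?q (b/2)"
        using d by (intro SUP_upper2[of "(x, y)"]) auto
      then have "ereal (dist (g x) (g y) / dist x y) < ereal K"
        using q by (rule le_less_trans)
      with False show ?thesis by (simp add: field_simps)
    qed simp
    with b(1) show "\<exists>e>0. \<forall>x y. dist x y < e \<longrightarrow> dist (g x) (g y) \<le> K * dist x y"
      by (intro exI[of _ "b/2"]) auto
  qed
next
  assume u: "small_scale_upper g c"
  show "Limsup (at_right 0) ?q \<le> ereal c"
    unfolding Limsup_le_iff
  proof (intro allI impI)
    fix w assume "ereal c < w"
    then obtain K where K: "c < K" "ereal K < w" using ereal_dense2 by fastforce
    then obtain e where e: "e > 0" "\<And>x y. dist x y < e \<Longrightarrow> dist (g x) (g y) \<le> K * dist x y"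
      using u unfolding small_scale_upper_def by blast
    have "?q r < w" if "r < e" for r
    proof -
      have "?q r \<le> ereal K"
      proof (intro SUP_least, clarify)
        fix x y :: 'a assume "0 < dist x y" "dist x y < r"
        with e(2)[of x y] that
        show "ereal (dist (g x) (g y) / dist x y) \<le> ereal K" by (simp add: field_simps)
      qed
      with K(2) show ?thesis by simp
    qed
    with e(1) show "\<forall>\<^sub>F r in at_right 0. ?q r < w"
      unfolding eventually_at_right_field by blast
  qed
qed

lemma Liminf_quotient_ge_iff:
  fixes g :: "'a::metric_space \<Rightarrow> 'b::metric_space"
  shows "Liminf (at_right (0::real)) (\<lambda>\<epsilon>. INF (x, y) \<in> {(x, y). 0 < dist x y \<and> dist x y < \<epsilon>}.
           ereal (dist (g x) (g y) / dist x y)) \<ge> ereal c \<longleftrightarrow> small_scale_lower g c"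
    (is "_ \<le> Liminf _ ?q \<longleftrightarrow> _")
proof
  assume L: "ereal c \<le> Liminf (at_right 0) ?q"
  show "small_scale_lower g c"
    unfolding small_scale_lower_def
  proof (intro allI impI)
    fix k assume "k < c"
    then have "\<forall>\<^sub>F e in at_right 0. ereal k < ?q e"
      using L unfolding le_Liminf_iff by auto
    then obtain b where b: "b > 0" "\<And>e. 0 < e \<Longrightarrow> e < b \<Longrightarrow> ereal k < ?q e"
      unfolding eventually_at_right_field by blast
    have q: "ereal k < ?q (b/2)" using b(2)[of "b/2"] b(1) by linarith
    have "k * dist x y \<le> dist (g x) (g y)" if d: "dist x y < b/2" for x y
    proof (cases "x = y")
      case False
      then have "?q (b/2) \<le> ereal (dist (g x) (g y) / dist x y)"
        using d by (intro INF_lower2[of "(x, y)"]) auto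
      with q have "ereal k < ereal (dist (g x) (g y) / dist x y)"
        by (rule less_le_trans)
      with False show ?thesis by (simp add: field_simps)
    qed simp
    with b(1) show "\<exists>e>0. \<forall>x y. dist x y < e \<longrightarrow> k * dist x y \<le> dist (g x) (g y)"
      by (intro exI[of _ "b/2"]) auto
  qed
next
  assume u: "small_scale_lower g c"
  show "ereal c \<le> Liminf (at_right 0) ?q"
    unfolding le_Liminf_iff
  proof (intro allI impI)
    fix w assume "w < ereal c"
    then obtain k where k: "k < c" "w < ereal k" using ereal_dense2 by fastforce
    then obtain e where e: "e > 0" "\<And>x y. dist x y < e \<Longrightarrow> k * dist x y \<le> dist (g x) (g y)"
      using u unfolding small_scale_lower_def by blast
    have "w < ?q r" if "r < e" for r
    proof -
      have "ereal k \<le> ?q r"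
      proof (intro INF_greatest, clarify)
        fix x y :: 'a assume "0 < dist x y" "dist x y < r"
        with e(2)[of x y] that
        show "ereal k \<le> ereal (dist (g x) (g y) / dist x y)" by (simp add: field_simps)
      qed
      with k(2) show ?thesis by simp
    qed
    with e(1) show "\<forall>\<^sub>F r in at_right 0. w < ?q r"
      unfolding eventually_at_right_field by blast
  qed
qed

section \<open>Local Lipschitz bounds are global in a length space\<close>

lemma curve_length_ge_subdivision:
  fixes g :: "real \<Rightarrow> 'a::metric_space"
  assumes "n > 0"
  shows "ennreal (\<Sum>i<n. dist (g (real i / real n)) (g (real (Suc i) / real n))) \<le> curve_length g"
proof -
  let ?t = "\<lambda>i. real i / real n"
  have "(n, ?t) \<in> {(n, t). mono_on {..n} t \<and> t 0 = 0 \<and> t n = 1}"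
    using assms by (auto intro!: mono_onI divide_right_mono)
  then have "(\<Sum>i<n. ennreal (dist (g (?t i)) (g (?t (Suc i))))) \<le> curve_length g"
    unfolding curve_length_def by (intro SUP_upper2[where i = "(n, ?t)"]) auto
  then show ?thesis by (simp add: sum_ennreal)
qed

text \<open>
  A nearly shortest curve from \<open>x\<close> to \<open>y\<close> is uniformly continuous, so a fine equidistant
  subdivision of its parameter interval consists of steps at which the small-scale bound applies.
  Adding up the steps replaces \<open>dist x y\<close> by the length of the curve, which costs an arbitrarily
  small \<open>\<eta>\<close>.
\<close>

lemma length_space_Lipschitz:
  fixes g :: "'a::metric_space \<Rightarrow> 'b::metric_space"
  assumes len: "length_metric_space TYPE('a)"
    and u: "small_scale_upper g c" and cK: "c < K" and K0: "0 \<le> K"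
  shows "dist (g x) (g y) \<le> K * dist x y"
proof -
  obtain e where e: "e > 0" "\<And>x y. dist x y < e \<Longrightarrow> dist (g x) (g y) \<le> K * dist x y"
    using u cK unfolding small_scale_upper_def by blast
  have *: "dist (g x) (g y) \<le> K * (dist x y + \<eta>)" if \<eta>: "\<eta> > 0" for \<eta>
  proof -
    have "(INF p \<in> {p. path p \<and> pathstart p = x \<and> pathfinish p = y}. curve_length p)
        = ennreal (dist x y)"
      using len unfolding length_metric_space_def by simp
    also have "\<dots> < ennreal (dist x y + \<eta>)" using \<eta> by (simp add: ennreal_less_iff)
    finally obtain p where p: "path p" "pathstart p = x" "pathfinish p = y"
        and l: "curve_length p < ennreal (dist x y + \<eta>)"
      unfolding INF_less_iff by blast
    have "uniformly_continuous_on {0..1} p"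
      using p(1) by (auto simp: path_def intro: compact_uniformly_continuous)
    then obtain d where d: "d > 0"
        "\<And>s t. s \<in> {0..1} \<Longrightarrow> t \<in> {0..1} \<Longrightarrow> dist s t < d \<Longrightarrow> dist (p s) (p t) < e"
      unfolding uniformly_continuous_on_def using e(1) by blast
    obtain n where n: "n > 0" "1 / real n < d"
      using d(1) real_arch_inverse[of d] by (auto simp: inverse_eq_divide)
    let ?t = "\<lambda>i. real i / real n"
    have step: "dist (p (?t i)) (p (?t (Suc i))) < e" if "i < n" for i
    proof (rule d(2))
      have "?t i - ?t (Suc i) = - (1 / real n)"
        using n(1) by (simp add: field_simps)
      then show "dist (?t i) (?t (Suc i)) < d" using n by (simp add: dist_real_def)
    qed (use that in auto)
    have tri: "dist (g (p (?t 0))) (g (p (?t m)))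
        \<le> (\<Sum>i<m. dist (g (p (?t i))) (g (p (?t (Suc i)))))" for m
    proof (induction m)
      case (Suc m)
      show ?case
        using Suc dist_triangle[of "g (p (?t 0))" "g (p (?t (Suc m)))" "g (p (?t m))"]
        by (auto simp del: of_nat_Suc)
    qed simp
    have "dist (g x) (g y) = dist (g (p (?t 0))) (g (p (?t n)))"
      using n(1) p by (simp add: pathstart_def pathfinish_def)
    also have "\<dots> \<le> (\<Sum>i<n. dist (g (p (?t i))) (g (p (?t (Suc i)))))" by (rule tri)
    also have "\<dots> \<le> (\<Sum>i<n. K * dist (p (?t i)) (p (?t (Suc i))))"
      using step by (intro sum_mono e(2)) auto
    also have "\<dots> = K * (\<Sum>i<n. dist (p (?t i)) (p (?t (Suc i))))"
      by (simp add: sum_distrib_left)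
    also have "\<dots> \<le> K * (dist x y + \<eta>)"
    proof (rule mult_left_mono[OF _ K0])
      have "ennreal (\<Sum>i<n. dist (p (?t i)) (p (?t (Suc i)))) < ennreal (dist x y + \<eta>)"
        using curve_length_ge_subdivision[OF n(1), of p] l by (rule le_less_trans)
      then show "(\<Sum>i<n. dist (p (?t i)) (p (?t (Suc i)))) \<le> dist x y + \<eta>"
        by (subst (asm) ennreal_less_iff) (auto intro: sum_nonneg)
    qed
    finally show ?thesis .
  qed
  show ?thesis
  proof (cases "K = 0")
    case True
    with *[of 1] show ?thesis by simp
  next
    case False
    with K0 have K: "K > 0" by simp
    show ?thesis
    proof (rule field_le_epsilon)
      fix r :: real assume "r > 0"
      then have "dist (g x) (g y) \<le> K * (dist x y + r / K)" using K by (intro *) simp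
      also have "\<dots> = K * dist x y + r" using K by (simp add: distrib_left)
      finally show "dist (g x) (g y) \<le> K * dist x y + r" .
    qed
  qed
qed

section \<open>Flows and their cones\<close>

text \<open>
  The last condition on flows: points ahead of \<open>y\<close> and points behind \<open>y\<close> are
  separated by a definite proportion of their distances to \<open>y\<close>.
\<close>

definition transverse_flow :: "'a::metric_space flow \<Rightarrow> bool" where
  "transverse_flow \<F> \<longleftrightarrow>
     (\<exists>C>0. \<exists>\<epsilon>\<^sub>0>0. \<exists>\<mu>\<^sub>0\<in>{0<..<1}.
        \<forall>\<epsilon>'\<in>{0<..<\<epsilon>\<^sub>0}. \<forall>\<epsilon>''\<in>{0<..<\<epsilon>\<^sub>0}. \<forall>\<mu>'\<in>{0<..<\<mu>\<^sub>0}. \<forall>\<mu>''\<in>{0<..<\<mu>\<^sub>0}. \<forall>x y z.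
          (y, z) \<in> Vplus \<F> \<epsilon>' \<mu>' \<and> (y, x) \<in> Vplus (reverse_flow \<F>) \<epsilon>'' \<mu>'' \<longrightarrow>
          dist x y + dist y z \<le> C * dist x z)"

lemma Lipflow_iff:
  "\<F> \<in> Lipflow \<longleftrightarrow>
     start_time \<F> < 0 \<and> 0 < end_time \<F> \<and>
     (\<forall>x. flow_map \<F> 0 x = x) \<and>
     equicontinuous_on (time_domain \<F>) {\<lambda>t. flow_map \<F> t x | x. True} \<and>
     (\<exists>M :: real \<Rightarrow> real.
        (\<forall>t\<in>time_domain \<F>. M t > 0) \<and>
        continuous (at 0 within time_domain \<F>) M \<and>
        (\<forall>t\<in>time_domain \<F>. small_scale_upper (flow_map \<F> t) (M t) \<and>
           small_scale_lower (flow_map \<F> t) (1 / M t))) \<and>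
     (\<forall>s\<in>time_domain \<F>. \<forall>t\<in>time_domain \<F>. s + t \<in> time_domain \<F> \<longrightarrow>
        (\<forall>x. flow_map \<F> (s + t) x = flow_map \<F> s (flow_map \<F> t x))) \<and>
     transverse_flow \<F>"
  unfolding Lipflow_def mem_Collect_eq Limsup_quotient_le_iff Liminf_quotient_ge_iff
    transverse_flow_def ..

lemma flow_map_0: "\<F> \<in> Lipflow \<Longrightarrow> flow_map \<F> 0 x = x"
  by (simp add: Lipflow_iff)

lemma zero_in_time_domain: "\<F> \<in> Lipflow \<Longrightarrow> 0 \<in> time_domain \<F>"
  by (simp add: Lipflow_iff time_domain_def)

lemma flow_map_add:
  "\<F> \<in> Lipflow \<Longrightarrow> s \<in> time_domain \<F> \<Longrightarrow> t \<in> time_domain \<F> \<Longrightarrow> s + t \<in> time_domain \<F> \<Longrightarrow>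
    flow_map \<F> (s + t) x = flow_map \<F> s (flow_map \<F> t x)"
  by (simp add: Lipflow_iff)

lemma flow_map_equicontinuous:
  assumes F: "\<F> \<in> Lipflow" and t: "t \<in> time_domain \<F>" and e: "e > 0"
  obtains \<delta> where "\<delta> > 0"
    "\<And>s x. s \<in> time_domain \<F> \<Longrightarrow> dist s t < \<delta> \<Longrightarrow> dist (flow_map \<F> s x) (flow_map \<F> t x) < e"
proof -
  have "equicontinuous_on (time_domain \<F>) {\<lambda>t. flow_map \<F> t x | x. True}"
    using F by (simp add: Lipflow_iff)
  from this[unfolded equicontinuous_on_def, rule_format, OF t e]
  obtain \<delta> where "\<delta> > 0" and \<delta>: "\<And>g s. g \<in> {\<lambda>t. flow_map \<F> t x | x. True} \<Longrightarrow>
      s \<in> time_domain \<F> \<Longrightarrow> dist s t < \<delta> \<Longrightarrow> dist (g s) (g t) < e"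
    by meson
  show thesis
  proof (rule that[OF \<open>\<delta> > 0\<close>])
    fix s x assume "s \<in> time_domain \<F>" "dist s t < \<delta>"
    then show "dist (flow_map \<F> s x) (flow_map \<F> t x) < e"
      by (intro \<delta>[of "\<lambda>t. flow_map \<F> t x"]) auto
  qed
qed

lemma time_domain_reverse_flow: "s \<in> time_domain (reverse_flow \<F>) \<longleftrightarrow> - s \<in> time_domain \<F>"
  by (auto simp: time_domain_def reverse_flow_def)

lemma flow_map_reverse_flow: "flow_map (reverse_flow \<F>) s = flow_map \<F> (- s)"
  by (simp add: reverse_flow_def)

lemma reverse_reverse_flow [simp]: "reverse_flow (reverse_flow \<F>) = \<F>"
  by (cases \<F>) (simp add: reverse_flow_def)

lemma continuous_flow_map:
  assumes "\<F> \<in> Lipflow" "t \<in> time_domain \<F>"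
  shows "continuous_on UNIV (flow_map \<F> t)"
proof -
  obtain c where c: "c > 0" "small_scale_upper (flow_map \<F> t) c"
    using assms unfolding Lipflow_iff by blast
  then obtain e where e: "e > 0"
      "\<And>x y. dist x y < e \<Longrightarrow> dist (flow_map \<F> t x) (flow_map \<F> t y) \<le> (c + 1) * dist x y"
    unfolding small_scale_upper_def by (meson less_add_one)
  show ?thesis
    unfolding continuous_on_iff
  proof (intro ballI allI impI)
    fix x and r :: real assume r: "r > 0"
    have "dist (flow_map \<F> t x') (flow_map \<F> t x) < r"
      if "dist x' x < min e (r / (c + 1))" for x'
    proof -
      have "(c + 1) * dist x' x < r" using that c(1) by (simp add: field_simps)
      with e(2)[of x' x] that show ?thesis by simp
    qed
    then show "\<exists>d>0. \<forall>x'\<in>UNIV. dist x' x < d \<longrightarrow> dist (flow_map \<F> t x') (flow_map \<F> t x) < r"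
      using e(1) r c(1) by (intro exI[of _ "min e (r / (c + 1))"]) auto
  qed
qed

text \<open>
  The scale below which the quotients of \<open>F t\<close> are controlled depends on \<open>t\<close>; passing to global
  bounds removes it. Near time \<open>0\<close> the bounds \<open>M t\<close> stay below \<open>M 0 + 1\<close> by continuity.
\<close>

lemma flow_short_times:
  fixes \<F> :: "'a::metric_space flow"
  assumes len: "length_metric_space TYPE('a)" and F: "\<F> \<in> Lipflow"
  obtains \<delta> K where "\<delta> > 0" "K \<ge> 1" "\<And>t. \<bar>t\<bar> < \<delta> \<Longrightarrow> t \<in> time_domain \<F>"
    "\<And>t x y. \<bar>t\<bar> < \<delta> \<Longrightarrow> dist (flow_map \<F> t x) (flow_map \<F> t y) \<le> K * dist x y"
proof -
  obtain M :: "real \<Rightarrow> real" where M: "\<And>t. t \<in> time_domain \<F> \<Longrightarrow> M t > 0"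
      "continuous (at 0 within time_domain \<F>) M"
      "\<And>t. t \<in> time_domain \<F> \<Longrightarrow> small_scale_upper (flow_map \<F> t) (M t)"
    using F unfolding Lipflow_iff by blast
  have M0: "M 0 > 0" using M(1) zero_in_time_domain[OF F] .
  obtain d where d: "d > 0" "\<And>t. t \<in> time_domain \<F> \<Longrightarrow> dist t 0 < d \<Longrightarrow> dist (M t) (M 0) < 1"
    using M(2) unfolding continuous_within_eps_delta by (meson zero_less_one)
  define \<delta> where "\<delta> = min d (min (- start_time \<F>) (end_time \<F>))"
  have \<delta>: "\<delta> > 0" using F d(1) by (simp add: \<delta>_def Lipflow_iff)
  have T: "t \<in> time_domain \<F>" if "\<bar>t\<bar> < \<delta>" for t
    using that by (auto simp: \<delta>_def time_domain_def)
  have L: "dist (flow_map \<F> t x) (flow_map \<F> t y) \<le> (M 0 + 1) * dist x y" if t: "\<bar>t\<bar> < \<delta>" for t x y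
  proof (rule length_space_Lipschitz[OF len M(3)[OF T[OF t]]])
    have "dist t 0 < d" using t by (simp add: \<delta>_def)
    then show "M t < M 0 + 1" using d(2)[OF T[OF t]] by (simp add: dist_real_def)
  qed (use M0 in simp)
  show thesis
    by (rule that[OF \<delta> _ T L]) (use M0 in auto)
qed

text \<open>
  The point of the orbit nearest to \<open>y\<close> need not be known: a strict inequality for an infimum is
  witnessed by some time. As \<open>infdist\<close> to the empty set is \<open>0\<close>, it matters that time \<open>0\<close> is
  available.
\<close>

lemma mem_Vplus_iff:
  assumes "0 \<in> time_domain \<F>" "\<epsilon> > 0"
  shows "(x, y) \<in> Vplus \<F> \<epsilon> \<mu> \<longleftrightarrow>
    (\<exists>s\<in>{0..\<epsilon>} \<inter> time_domain \<F>. dist y (flow_map \<F> s x) < \<mu> * dist x y)"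
proof -
  let ?A = "(\<lambda>s. flow_map \<F> s x) ` ({0..\<epsilon>} \<inter> time_domain \<F>)"
  have ne: "?A \<noteq> {}" using assms by force
  have "(x, y) \<in> Vplus \<F> \<epsilon> \<mu> \<longleftrightarrow> (INF a\<in>?A. dist y a) < \<mu> * dist x y"
    by (simp only: Vplus_def mem_Collect_eq case_prod_conv infdist_notempty[OF ne])
  also have "\<dots> \<longleftrightarrow> (\<exists>a\<in>?A. dist y a < \<mu> * dist x y)"
    by (rule cINF_less_iff[OF ne]) simp
  finally show ?thesis by simp
qed

lemma Vplus_mono:
  assumes "\<F> \<in> Lipflow" "0 < \<epsilon>" "\<epsilon> \<le> \<epsilon>'" "\<mu> \<le> \<mu>'"
  shows "Vplus \<F> \<epsilon> \<mu> \<subseteq> Vplus \<F> \<epsilon>' \<mu>'"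
proof clarify
  fix x y assume "(x, y) \<in> Vplus \<F> \<epsilon> \<mu>"
  then obtain s where s: "s \<in> {0..\<epsilon>} \<inter> time_domain \<F>" "dist y (flow_map \<F> s x) < \<mu> * dist x y"
    using mem_Vplus_iff[OF zero_in_time_domain[OF assms(1)] assms(2)] by blast
  have "\<mu> * dist x y \<le> \<mu>' * dist x y" using assms(4) by (simp add: mult_right_mono)
  then show "(x, y) \<in> Vplus \<F> \<epsilon>' \<mu>'"
    using s assms(2,3) mem_Vplus_iff[OF zero_in_time_domain[OF assms(1)], of \<epsilon>' x y \<mu>'] by force
qed

text \<open>
  For a fixed time the defining inequality compares two continuous functions of \<open>(x, y)\<close>, and a cone
  is a union over times.
\<close>

lemma open_Vplus:
  assumes "\<F> \<in> Lipflow" "\<epsilon> > 0"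
  shows "open (Vplus \<F> \<epsilon> \<mu>)"
proof -
  have "Vplus \<F> \<epsilon> \<mu> =
      (\<Union>s\<in>{0..\<epsilon>} \<inter> time_domain \<F>. {p. dist (snd p) (flow_map \<F> s (fst p)) < \<mu> * dist (fst p) (snd p)})"
    using mem_Vplus_iff[OF zero_in_time_domain[OF assms(1)] assms(2)] by fastforce
  also have "open \<dots>"
  proof (intro open_UN ballI open_Collect_less)
    fix s assume "s \<in> {0..\<epsilon>} \<inter> time_domain \<F>"
    then have c: "continuous_on UNIV (flow_map \<F> s)" by (intro continuous_flow_map[OF assms(1)]) simp
    show "continuous_on UNIV (\<lambda>p. dist (snd p) (flow_map \<F> s (fst p)))"
      by (intro continuous_intros continuous_on_compose2[OF c]) auto
  qed (intro continuous_intros)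
  finally show ?thesis .
qed

text \<open>
  Flow \<open>y \<approx> F s x\<close> back for time \<open>s\<close>: the point \<open>F s x\<close> returns to \<open>x\<close>, and the error grows by
  at most the Lipschitz constant of \<open>F (- s)\<close>.
\<close>

lemma Vplus_reverse:
  fixes \<F> :: "'a::metric_space flow"
  assumes len: "length_metric_space TYPE('a)" and F: "\<F> \<in> Lipflow" "reverse_flow \<F> \<in> Lipflow"
  obtains \<delta> K where "\<delta> > 0" "K \<ge> 1"
    "\<And>x y \<epsilon> \<mu>. 0 < \<epsilon> \<Longrightarrow> \<epsilon> < \<delta> \<Longrightarrow> (x, y) \<in> Vplus \<F> \<epsilon> \<mu> \<Longrightarrow> (y, x) \<in> Vplus (reverse_flow \<F>) \<epsilon> (K * \<mu>)"
proof -
  obtain \<delta> K where d: "\<delta> > 0" "K \<ge> 1" "\<And>t. \<bar>t\<bar> < \<delta> \<Longrightarrow> t \<in> time_domain \<F>"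
    "\<And>t x y. \<bar>t\<bar> < \<delta> \<Longrightarrow> dist (flow_map \<F> t x) (flow_map \<F> t y) \<le> K * dist x y"
    by (rule flow_short_times[OF len F(1)], rule that) blast+
  have "(y, x) \<in> Vplus (reverse_flow \<F>) \<epsilon> (K * \<mu>)"
    if e: "0 < \<epsilon>" "\<epsilon> < \<delta>" and V: "(x, y) \<in> Vplus \<F> \<epsilon> \<mu>" for x y \<epsilon> \<mu>
  proof -
    obtain s where s: "s \<in> {0..\<epsilon>}" "dist y (flow_map \<F> s x) < \<mu> * dist x y"
      using V mem_Vplus_iff[OF zero_in_time_domain[OF F(1)] e(1)] by blast
    have sd: "\<bar>s\<bar> < \<delta>" "\<bar>-s\<bar> < \<delta>" "\<bar>0::real\<bar> < \<delta>" using s(1) e by auto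
    have "flow_map \<F> (- s) (flow_map \<F> s x) = flow_map \<F> (- s + s) x"
      using d(3) sd by (intro flow_map_add[OF F(1), symmetric]) auto
    also have "\<dots> = x" by (simp add: flow_map_0[OF F(1)])
    finally have "dist x (flow_map \<F> (- s) y) = dist (flow_map \<F> (- s) (flow_map \<F> s x)) (flow_map \<F> (- s) y)"
      by simp
    also have "\<dots> \<le> K * dist (flow_map \<F> s x) y" using d(4) sd by blast
    also have "\<dots> < K * \<mu> * dist y x"
      using s(2) d(2) by (simp add: dist_commute mult.assoc)
    finally show ?thesis
      using s(1) d(3) sd
      by (subst mem_Vplus_iff[OF zero_in_time_domain[OF F(2)] e(1)])
        (auto simp: time_domain_reverse_flow flow_map_reverse_flow intro!: bexI[of _ s])
  qed
  with d(1,2) show thesis using that by blast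
qed

section \<open>The filter of a flow\<close>

lemma flow_ofilter_eq_1_iff:
  assumes "open D"
  shows "flow_ofilter \<F> D = 1 \<longleftrightarrow> (\<exists>\<epsilon> \<mu>. \<epsilon> > 0 \<and> 0 < \<mu> \<and> \<mu> < 1 \<and> Vplus \<F> \<epsilon> \<mu> \<subseteq> D)"
  using assms by (auto simp: flow_ofilter_def generated_ofilter_def)

lemma flow_ofilter_01: "flow_ofilter \<F> \<in> {A. open A} \<rightarrow>\<^sub>E {0, 1}"
  by (auto simp: flow_ofilter_def generated_ofilter_def)

lemma flow_ofilter_cases:
  assumes "open D"
  obtains "flow_ofilter \<F> D = 0" | "flow_ofilter \<F> D = 1"
  using assms PiE_mem[OF flow_ofilter_01, of D \<F>] by auto

lemma is_ofilter_flow_ofilter: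
  assumes F: "\<F> \<in> Lipflow"
  shows "is_ofilter (flow_ofilter \<F>)"
  unfolding is_ofilter_def
proof (intro conjI allI impI)
  show "flow_ofilter \<F> \<in> {A. open A} \<rightarrow>\<^sub>E {0, 1}" by (rule flow_ofilter_01)
  have "(0::real) < 1/2" "(1/2::real) < 1" by auto
  then show "flow_ofilter \<F> UNIV = 1" unfolding flow_ofilter_eq_1_iff[OF open_UNIV] by blast
  fix A B :: "('a \<times> 'a) set" assume o: "open A" "open B"
  show le: "flow_ofilter \<F> A \<le> flow_ofilter \<F> B" if "A \<subseteq> B" "open A" "open B" for A B
    using flow_ofilter_eq_1_iff[OF that(2), of \<F>] flow_ofilter_eq_1_iff[OF that(3), of \<F>]
    by (cases rule: flow_ofilter_cases[OF that(2), of \<F>])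
      (use that(1) in \<open>auto dest: subset_trans[OF _ that(1)]\<close>)
  have int: "flow_ofilter \<F> (A \<inter> B) = 1" if AB: "flow_ofilter \<F> A = 1" "flow_ofilter \<F> B = 1"
  proof -
    obtain e m e' m' where
      1: "e > 0" "0 < m" "m < 1" "Vplus \<F> e m \<subseteq> A" "e' > 0" "0 < m'" "m' < 1" "Vplus \<F> e' m' \<subseteq> B"
      using AB unfolding flow_ofilter_eq_1_iff[OF o(1)] flow_ofilter_eq_1_iff[OF o(2)] by blast
    have "Vplus \<F> (min e e') (min m m') \<subseteq> A \<inter> B"
      using Vplus_mono[OF F, of "min e e'" e "min m m'" m]
        Vplus_mono[OF F, of "min e e'" e' "min m m'" m'] 1 by auto
    moreover have "0 < min e e'" "0 < min m m'" "min m m' < 1" using 1 by auto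
    ultimately show ?thesis unfolding flow_ofilter_eq_1_iff[OF open_Int[OF o]] by blast
  qed
  have "open (A \<union> B)" "open (A \<inter> B)" using o by auto
  then show "flow_ofilter \<F> A + flow_ofilter \<F> B \<le> flow_ofilter \<F> (A \<union> B) + flow_ofilter \<F> (A \<inter> B)"
    using int le[of A "A \<union> B"] le[of B "A \<union> B"] o
    by (cases rule: flow_ofilter_cases[OF o(1), of \<F>]; cases rule: flow_ofilter_cases[OF o(2), of \<F>]) auto
qed

text \<open>
  Short orbits are uniformly small by equicontinuity at time \<open>0\<close>. If \<open>(x, y)\<close> is in the cone of
  aperture \<open>1/2\<close>, the error is at most half of \<open>dist x y\<close>, so \<open>dist x y\<close> is at most twice the
  displacement of \<open>x\<close> by the flow.
\<close>

lemma flow_ofilter_ge_uniformity: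
  assumes F: "\<F> \<in> Lipflow"
  shows "ofilter_ge (flow_ofilter \<F>) uniformity_ofilter"
  unfolding ofilter_ge_def
proof (intro allI impI)
  fix D :: "('a \<times> 'a) set" assume D: "open D"
  show "uniformity_ofilter D \<le> flow_ofilter \<F> D"
  proof (cases "\<exists>r>0. {(x, y). dist x y < r} \<subseteq> D")
    case True
    then obtain r where r: "r > 0" "{(x, y). dist x y < r} \<subseteq> D" by blast
    obtain \<delta> where \<delta>: "\<delta> > 0"
        "\<And>s x. s \<in> time_domain \<F> \<Longrightarrow> dist s 0 < \<delta> \<Longrightarrow> dist (flow_map \<F> s x) (flow_map \<F> 0 x) < r / 2"
      using r(1) by (auto intro: flow_map_equicontinuous[OF F zero_in_time_domain[OF F], of "r / 2"])
    have "Vplus \<F> (\<delta> / 2) (1 / 2) \<subseteq> D"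
    proof clarify
      fix x y assume "(x, y) \<in> Vplus \<F> (\<delta> / 2) (1 / 2)"
      then obtain s where s: "s \<in> {0..\<delta>/2} \<inter> time_domain \<F>" "dist y (flow_map \<F> s x) < 1 / 2 * dist x y"
        using mem_Vplus_iff[OF zero_in_time_domain[OF F], of "\<delta>/2"] \<delta>(1) by auto
      have "dist (flow_map \<F> s x) x < r / 2"
        using \<delta>(2)[of s x] \<delta>(1) s(1) by (auto simp: flow_map_0[OF F])
      then have "dist x y < r"
        using s(2) dist_triangle[of x y "flow_map \<F> s x"] by (simp add: dist_commute)
      with r(2) show "(x, y) \<in> D" by blast
    qed
    moreover have "\<delta> / 2 > 0" "(0::real) < 1/2" "(1/2::real) < 1" using \<delta> by auto
    ultimately have "flow_ofilter \<F> D = 1"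
      unfolding flow_ofilter_eq_1_iff[OF D] by blast
    with D show ?thesis by (simp add: uniformity_ofilter_def)
  next
    case False
    with D have "uniformity_ofilter D = 0"
      by (simp only: uniformity_ofilter_def restrict_apply mem_Collect_eq if_True if_False)
    then show ?thesis by simp
  qed
qed

text \<open>
  Composing two steps adds their times and gives an error proportional to
  \<open>dist x y + dist y z\<close>. Transversality turns this sum into a multiple of \<open>dist x z\<close>, once the
  first step has been reversed so that \<open>x\<close> is seen to lie behind \<open>y\<close>.
\<close>

lemma Vplus_relcomp:
  fixes \<F> :: "'a::metric_space flow"
  assumes len: "length_metric_space TYPE('a)" and F: "\<F> \<in> Lipflow" "reverse_flow \<F> \<in> Lipflow"
    and \<epsilon>: "\<epsilon> > 0" and \<mu>: "\<mu> > 0"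
  obtains \<epsilon>' \<mu>' where "\<epsilon>' > 0" "0 < \<mu>'" "\<mu>' < 1"
    "Vplus \<F> \<epsilon>' \<mu>' O Vplus \<F> \<epsilon>' \<mu>' \<subseteq> Vplus \<F> \<epsilon> \<mu>"
proof -
  obtain \<delta> K where d: "\<delta> > 0" "K \<ge> 1" "\<And>t. \<bar>t\<bar> < \<delta> \<Longrightarrow> t \<in> time_domain \<F>"
    "\<And>t x y. \<bar>t\<bar> < \<delta> \<Longrightarrow> dist (flow_map \<F> t x) (flow_map \<F> t y) \<le> K * dist x y"
    by (rule flow_short_times[OF len F(1)], rule that) blast+
  obtain \<delta>' K' where d': "\<delta>' > 0" "K' \<ge> 1"
    "\<And>x y \<epsilon> \<mu>. 0 < \<epsilon> \<Longrightarrow> \<epsilon> < \<delta>' \<Longrightarrow> (x, y) \<in> Vplus \<F> \<epsilon> \<mu> \<Longrightarrow> (y, x) \<in> Vplus (reverse_flow \<F>) \<epsilon> (K' * \<mu>)"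
    by (rule Vplus_reverse[OF len F], rule that) blast+
  obtain C e0 m0 where C: "C > 0" "e0 > 0" "0 < m0" "m0 < 1"
    and tr: "\<forall>e'\<in>{0<..<e0}. \<forall>e''\<in>{0<..<e0}. \<forall>m'\<in>{0<..<m0}. \<forall>m''\<in>{0<..<m0}. \<forall>x y z.
       (y, z) \<in> Vplus \<F> e' m' \<and> (y, x) \<in> Vplus (reverse_flow \<F>) e'' m'' \<longrightarrow>
          dist x y + dist y z \<le> C * dist x z"
    using F(1) unfolding Lipflow_iff transverse_flow_def by auto
  \<comment> \<open>Two successive times up to \<open>e\<close> must add up to less than \<open>\<delta>\<close>. The aperture \<open>m\<close> must stay below
    \<open>m0\<close> even after the reversal, and the composed error \<open>K * m * C\<close> must not exceed \<open>\<mu>\<close>.\<close>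
  define e where "e = min \<epsilon> (min \<delta> (min \<delta>' e0)) / 3"
  define m where "m = min (m0 / (2 * K')) (\<mu> / (K * C))"
  have e: "e > 0" "2 * e \<le> \<epsilon>" "2 * e < \<delta>" "e < \<delta>'" "e < e0"
    using \<epsilon> d(1) d'(1) C(2) by (auto simp: e_def min_def)
  have m: "m > 0" using \<mu> d(2) d'(2) C by (auto simp: m_def)
  have "m \<le> m0 / (2 * K')" by (simp add: m_def)
  then have "m * (2 * K') \<le> m0" using d'(2) by (simp add: field_simps)
  then have "2 * (K' * m) \<le> m0" by (simp add: mult_ac)
  then have K'm: "K' * m < m0" using C(3) by simp
  have "1 * m \<le> K' * m" using m d'(2) by (intro mult_right_mono) auto
  then have mm0: "m < m0" using K'm by simp
  have "m \<le> \<mu> / (K * C)" by (simp add: m_def)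
  then have KCm: "K * m * C \<le> \<mu>" using d(2) C(1) by (simp add: field_simps)
  have "(x, z) \<in> Vplus \<F> \<epsilon> \<mu>" if xy: "(x, y) \<in> Vplus \<F> e m" and yz: "(y, z) \<in> Vplus \<F> e m" for x y z
  proof -
    obtain s where s: "s \<in> {0..e}" "dist y (flow_map \<F> s x) < m * dist x y"
      using xy mem_Vplus_iff[OF zero_in_time_domain[OF F(1)] e(1)] by blast
    obtain t where t: "t \<in> {0..e}" "dist z (flow_map \<F> t y) < m * dist y z"
      using yz mem_Vplus_iff[OF zero_in_time_domain[OF F(1)] e(1)] by blast
    have "(y, x) \<in> Vplus (reverse_flow \<F>) e (K' * m)" using d'(3) e xy by blast
    then have sum_le: "dist x y + dist y z \<le> C * dist x z"
      using tr[rule_format, of e e m "K' * m" y z x] yz e m d'(2) mm0 K'm by auto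
    have st: "\<bar>t\<bar> < \<delta>" "\<bar>s\<bar> < \<delta>" "t + s \<in> time_domain \<F>" "t + s \<in> {0..\<epsilon>}"
      using s(1) t(1) e d(3)[of "t + s"] by auto
    have "dist z (flow_map \<F> (t + s) x) = dist z (flow_map \<F> t (flow_map \<F> s x))"
      using flow_map_add[OF F(1)] d(3) st by simp
    also have "\<dots> \<le> dist z (flow_map \<F> t y) + dist (flow_map \<F> t y) (flow_map \<F> t (flow_map \<F> s x))"
      by (rule dist_triangle)
    also have "\<dots> \<le> dist z (flow_map \<F> t y) + K * dist y (flow_map \<F> s x)"
      using d(4)[OF st(1)] by simp
    also have "\<dots> < m * dist y z + K * (m * dist x y)"
      using s(2) t(2) d(2) by (intro add_less_le_mono mult_left_mono) auto
    also have "\<dots> \<le> K * (m * dist y z) + K * (m * dist x y)"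
      using d(2) m mult_right_mono[of 1 K "m * dist y z"] by simp
    also have "\<dots> = K * m * (dist x y + dist y z)" by (simp add: algebra_simps)
    also have "\<dots> \<le> K * m * (C * dist x z)" using sum_le d(2) m by (intro mult_left_mono) auto
    also have "\<dots> \<le> \<mu> * dist x z" using KCm mult_right_mono[OF KCm, of "dist x z"] by (simp add: mult.assoc)
    finally show ?thesis using st mem_Vplus_iff[OF zero_in_time_domain[OF F(1)] \<epsilon>] by blast
  qed
  then show thesis using that[of e m] e m mm0 C(4) by force
qed

text \<open>
  Filters generated by cones agree as soon as each cone of either family contains one of the other.
  This criterion serves both for the exchange of coordinates and for bi-Lipschitz maps.
\<close>

lemma push_flow_ofilter:
  assumes g: "continuous_on UNIV g"
    and FG: "\<And>\<epsilon> \<mu>. \<epsilon> > 0 \<Longrightarrow> 0 < \<mu> \<Longrightarrow> \<mu> < 1 \<Longrightarrow>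
      \<exists>\<epsilon>'>0. \<exists>\<mu>'>0. \<mu>' < 1 \<and> g ` Vplus \<F> \<epsilon>' \<mu>' \<subseteq> Vplus \<G> \<epsilon> \<mu>"
    and GF: "\<And>\<epsilon> \<mu>. \<epsilon> > 0 \<Longrightarrow> 0 < \<mu> \<Longrightarrow> \<mu> < 1 \<Longrightarrow>
      \<exists>\<epsilon>'>0. \<exists>\<mu>'>0. \<mu>' < 1 \<and> Vplus \<G> \<epsilon>' \<mu>' \<subseteq> g ` Vplus \<F> \<epsilon> \<mu>"
  shows "push_ofilter g (flow_ofilter \<F>) = flow_ofilter \<G>"
proof (rule PiE_ext[of _ "{A. open A}" "\<lambda>_. {0, 1}"])
  have op: "open (g -` A)" if "open A" for A
    using g that by (simp add: open_vimage)
  show "push_ofilter g (flow_ofilter \<F>) \<in> {A. open A} \<rightarrow>\<^sub>E {0, 1}"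
    using PiE_mem[OF flow_ofilter_01, of _ \<F>] op by (auto simp: push_ofilter_def)
  show "flow_ofilter \<G> \<in> {A. open A} \<rightarrow>\<^sub>E {0, 1}" by (rule flow_ofilter_01)
  fix A :: "('b \<times> 'b) set" assume "A \<in> {A. open A}"
  then have A: "open A" by simp
  have "flow_ofilter \<F> (g -` A) = 1 \<longleftrightarrow> (\<exists>\<epsilon> \<mu>. \<epsilon> > 0 \<and> 0 < \<mu> \<and> \<mu> < 1 \<and> g ` Vplus \<F> \<epsilon> \<mu> \<subseteq> A)"
    unfolding flow_ofilter_eq_1_iff[OF op[OF A]] by (simp add: image_subset_iff_subset_vimage)
  also have "\<dots> \<longleftrightarrow> (\<exists>\<epsilon> \<mu>. \<epsilon> > 0 \<and> 0 < \<mu> \<and> \<mu> < 1 \<and> Vplus \<G> \<epsilon> \<mu> \<subseteq> A)"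
    using FG GF by (meson order_trans)
  also have "\<dots> \<longleftrightarrow> flow_ofilter \<G> A = 1" by (rule flow_ofilter_eq_1_iff[OF A, symmetric])
  finally have "flow_ofilter \<F> (g -` A) = flow_ofilter \<G> A"
    by (cases rule: flow_ofilter_cases[OF A, of \<G>]; cases rule: flow_ofilter_cases[OF op[OF A], of \<F>])
      auto
  then show "push_ofilter g (flow_ofilter \<F>) A = flow_ofilter \<G> A"
    using A by (simp add: push_ofilter_def)
qed

section \<open>Time reversal\<close>

text \<open>
  Reversing time exchanges ahead and behind, and the estimate is symmetric in \<open>x\<close> and \<open>z\<close>.
\<close>

lemma transverse_reverse_flow: "transverse_flow \<F> \<Longrightarrow> transverse_flow (reverse_flow \<F>)"
  unfolding transverse_flow_def reverse_reverse_flow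
proof (elim exE bexE conjE)
  fix C e0 m0 :: real
  assume C: "0 < C" "0 < e0" "m0 \<in> {0<..<1}"
    and tr: "\<forall>e'\<in>{0<..<e0}. \<forall>e''\<in>{0<..<e0}. \<forall>m'\<in>{0<..<m0}. \<forall>m''\<in>{0<..<m0}. \<forall>x y z.
       (y, z) \<in> Vplus \<F> e' m' \<and> (y, x) \<in> Vplus (reverse_flow \<F>) e'' m'' \<longrightarrow>
          dist x y + dist y z \<le> C * dist x z"
  have "dist x y + dist y z \<le> C * dist x z"
    if "e' \<in> {0<..<e0}" "e'' \<in> {0<..<e0}" "m' \<in> {0<..<m0}" "m'' \<in> {0<..<m0}"
      "(y, z) \<in> Vplus (reverse_flow \<F>) e' m'" "(y, x) \<in> Vplus \<F> e'' m''" for e' e'' m' m'' x y z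
    using tr[rule_format, OF that(2,1,4,3) conjI[OF that(6,5)]] by (simp add: dist_commute)
  with C show "\<exists>C>0. \<exists>\<epsilon>\<^sub>0>0. \<exists>\<mu>\<^sub>0\<in>{0<..<1}.
        \<forall>\<epsilon>'\<in>{0<..<\<epsilon>\<^sub>0}. \<forall>\<epsilon>''\<in>{0<..<\<epsilon>\<^sub>0}. \<forall>\<mu>'\<in>{0<..<\<mu>\<^sub>0}. \<forall>\<mu>''\<in>{0<..<\<mu>\<^sub>0}. \<forall>x y z.
          (y, z) \<in> Vplus (reverse_flow \<F>) \<epsilon>' \<mu>' \<and> (y, x) \<in> Vplus \<F> \<epsilon>'' \<mu>'' \<longrightarrow>
          dist x y + dist y z \<le> C * dist x z"
    by blast
qed

lemma reverse_flow_Lipflow: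
  assumes F: "\<F> \<in> Lipflow"
  shows "reverse_flow \<F> \<in> Lipflow"
  unfolding Lipflow_iff
proof (intro conjI ballI allI impI)
  show "start_time (reverse_flow \<F>) < 0" "0 < end_time (reverse_flow \<F>)"
    using F by (auto simp: Lipflow_iff reverse_flow_def)
  show "flow_map (reverse_flow \<F>) 0 x = x" for x
    by (simp add: flow_map_reverse_flow flow_map_0[OF F])
  show "transverse_flow (reverse_flow \<F>)"
    using F by (simp add: Lipflow_iff transverse_reverse_flow)
  show "flow_map (reverse_flow \<F>) (s + t) x = flow_map (reverse_flow \<F>) s (flow_map (reverse_flow \<F>) t x)"
    if "s \<in> time_domain (reverse_flow \<F>)" "t \<in> time_domain (reverse_flow \<F>)"
      "s + t \<in> time_domain (reverse_flow \<F>)" for s t x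
    using that flow_map_add[OF F, of "- s" "- t" x]
    by (simp add: flow_map_reverse_flow time_domain_reverse_flow)
  show "equicontinuous_on (time_domain (reverse_flow \<F>)) {\<lambda>t. flow_map (reverse_flow \<F>) t x | x. True}"
    unfolding equicontinuous_on_def
  proof (intro ballI allI impI)
    fix t and e :: real assume t: "t \<in> time_domain (reverse_flow \<F>)" and e: "e > 0"
    obtain \<delta> where \<delta>: "\<delta> > 0" "\<And>s x. s \<in> time_domain \<F> \<Longrightarrow> dist s (- t) < \<delta> \<Longrightarrow>
        dist (flow_map \<F> s x) (flow_map \<F> (- t) x) < e"
      by (rule flow_map_equicontinuous[OF F t[unfolded time_domain_reverse_flow] e], rule that) blast+
    have "dist (flow_map (reverse_flow \<F>) s x) (flow_map (reverse_flow \<F>) t x) < e"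
      if "s \<in> time_domain (reverse_flow \<F>)" "dist s t < \<delta>" for s x
      using \<delta>(2)[of "- s" x] that
      by (simp add: flow_map_reverse_flow time_domain_reverse_flow dist_minus)
    with \<delta>(1) show "\<exists>\<delta>>0. \<forall>g\<in>{\<lambda>t. flow_map (reverse_flow \<F>) t x | x. True}.
        \<forall>s\<in>time_domain (reverse_flow \<F>). dist s t < \<delta> \<longrightarrow> dist (g s) (g t) < e"
      by blast
  qed
  obtain M :: "real \<Rightarrow> real" where M: "\<And>t. t \<in> time_domain \<F> \<Longrightarrow> M t > 0"
      "continuous (at 0 within time_domain \<F>) M"
      "\<And>t. t \<in> time_domain \<F> \<Longrightarrow> small_scale_upper (flow_map \<F> t) (M t)"
      "\<And>t. t \<in> time_domain \<F> \<Longrightarrow> small_scale_lower (flow_map \<F> t) (1 / M t)"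
    using F unfolding Lipflow_iff by blast
  have "continuous (at 0 within time_domain (reverse_flow \<F>)) (\<lambda>t. M (- t))"
    unfolding continuous_within_eps_delta
  proof (intro allI impI)
    fix e :: real assume "e > 0"
    then obtain d where "d > 0" "\<And>t. t \<in> time_domain \<F> \<Longrightarrow> dist t 0 < d \<Longrightarrow> dist (M t) (M 0) < e"
      using M(2) unfolding continuous_within_eps_delta by meson
    then show "\<exists>d>0. \<forall>t\<in>time_domain (reverse_flow \<F>). dist t 0 < d \<longrightarrow> dist (M (- t)) (M (- 0)) < e"
      by (intro exI[of _ d]) (auto simp: time_domain_reverse_flow)
  qed
  then show "\<exists>M :: real \<Rightarrow> real. (\<forall>t\<in>time_domain (reverse_flow \<F>). M t > 0) \<and>
        continuous (at 0 within time_domain (reverse_flow \<F>)) M \<and>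
        (\<forall>t\<in>time_domain (reverse_flow \<F>). small_scale_upper (flow_map (reverse_flow \<F>) t) (M t) \<and>
           small_scale_lower (flow_map (reverse_flow \<F>) t) (1 / M t))"
    using M(1,3,4) by (intro exI[of _ "\<lambda>t. M (- t)"])
      (simp add: flow_map_reverse_flow time_domain_reverse_flow)
qed

text \<open>
  Time reversal is an involution, so the inclusion of cones given by \<open>Vplus_reverse\<close>, applied
  to the flow and to its reversal, yields both inclusions needed for equality of the filters.
\<close>

lemma swap_flow_ofilter:
  fixes \<F> :: "'a::metric_space flow"
  assumes len: "length_metric_space TYPE('a)" and F: "\<F> \<in> Lipflow"
  shows "push_ofilter prod.swap (flow_ofilter \<F>) = flow_ofilter (reverse_flow \<F>)"
proof (rule push_flow_ofilter)
  show "continuous_on UNIV (prod.swap :: 'a \<times> 'a \<Rightarrow> _)" by (rule continuous_on_swap)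
  have *: "\<exists>\<epsilon>'>0. \<exists>\<mu>'>0. \<mu>' < 1 \<and> prod.swap ` Vplus \<G> \<epsilon>' \<mu>' \<subseteq> Vplus (reverse_flow \<G>) \<epsilon> \<mu>"
    if G: "\<G> \<in> Lipflow" and e: "\<epsilon> > 0" and m: "0 < \<mu>" "\<mu> < 1" for \<epsilon> \<mu> and \<G> :: "'a flow"
  proof -
    have G': "reverse_flow \<G> \<in> Lipflow" using G by (rule reverse_flow_Lipflow)
    obtain \<delta> K where d: "\<delta> > 0" "K \<ge> 1"
      "\<And>x y \<epsilon> \<mu>. 0 < \<epsilon> \<Longrightarrow> \<epsilon> < \<delta> \<Longrightarrow> (x, y) \<in> Vplus \<G> \<epsilon> \<mu> \<Longrightarrow> (y, x) \<in> Vplus (reverse_flow \<G>) \<epsilon> (K * \<mu>)"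
      by (rule Vplus_reverse[OF len G G'], rule that) blast+
    \<comment> \<open>\<open>Vplus_reverse\<close> needs times strictly below \<open>\<delta>\<close>.\<close>
    let ?e = "min \<epsilon> (\<delta> / 2)"
    have e': "0 < ?e" "?e < \<delta>" "?e \<le> \<epsilon>" using e d(1) by auto
    have "\<mu> / K \<le> \<mu>" using m d(2) by (simp add: field_simps)
    then have m': "0 < \<mu> / K" "\<mu> / K < 1" using m d(2) by auto
    have "(y, x) \<in> Vplus (reverse_flow \<G>) \<epsilon> \<mu>" if "(x, y) \<in> Vplus \<G> ?e (\<mu> / K)" for x y
      using d(3)[OF e'(1,2) that] Vplus_mono[OF G' e'(1,3), of \<mu> \<mu>] d(2) by auto
    then show ?thesis using e'(1) m' by (intro exI[of _ ?e] exI[of _ "\<mu> / K"] conjI) auto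
  qed
  fix \<epsilon> \<mu> :: real assume em: "\<epsilon> > 0" "0 < \<mu>" "\<mu> < 1"
  show "\<exists>\<epsilon>'>0. \<exists>\<mu>'>0. \<mu>' < 1 \<and> prod.swap ` Vplus \<F> \<epsilon>' \<mu>' \<subseteq> Vplus (reverse_flow \<F>) \<epsilon> \<mu>"
    using *[OF F em] .
  obtain \<epsilon>' \<mu>' where "\<epsilon>' > 0" "\<mu>' > 0" "\<mu>' < 1"
      and sub: "prod.swap ` Vplus (reverse_flow \<F>) \<epsilon>' \<mu>' \<subseteq> Vplus \<F> \<epsilon> \<mu>"
    using *[OF reverse_flow_Lipflow[OF F] em] by auto
  moreover have "Vplus (reverse_flow \<F>) \<epsilon>' \<mu>' \<subseteq> prod.swap ` Vplus \<F> \<epsilon> \<mu>"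
    using image_mono[OF sub, of prod.swap] by (simp add: image_image)
  ultimately show "\<exists>\<epsilon>'>0. \<exists>\<mu>'>0. \<mu>' < 1 \<and> Vplus (reverse_flow \<F>) \<epsilon>' \<mu>' \<subseteq> prod.swap ` Vplus \<F> \<epsilon> \<mu>"
    by blast
qed

lemma uniform_refinement_flow_refinement:
  assumes len: "length_metric_space TYPE('a::metric_space)"
  shows "uniform_refinement (flow_refinement :: ('a \<times> 'a) ofilter set)"
  unfolding uniform_refinement_def
proof (intro ballI conjI allI impI)
  fix \<nu> :: "('a \<times> 'a) ofilter" assume "\<nu> \<in> flow_refinement"
  then obtain \<F> where \<nu>: "\<nu> = flow_ofilter \<F>" and F: "\<F> \<in> Lipflow"
    unfolding flow_refinement_def by blast
  have F': "reverse_flow \<F> \<in> Lipflow" using F by (rule reverse_flow_Lipflow)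
  show "is_ofilter \<nu>" "ofilter_ge \<nu> uniformity_ofilter"
    using F \<nu> by (auto simp: is_ofilter_flow_ofilter flow_ofilter_ge_uniformity)
  show "push_ofilter prod.swap \<nu> \<in> flow_refinement"
    using swap_flow_ofilter[OF len F] F' \<nu> by (auto simp: flow_refinement_def)
  fix D assume D: "open D \<and> \<nu> D = 1"
  then obtain \<epsilon> \<mu> where em: "\<epsilon> > 0" "0 < \<mu>" "Vplus \<F> \<epsilon> \<mu> \<subseteq> D"
    using \<nu> flow_ofilter_eq_1_iff by blast
  obtain \<epsilon>' \<mu>' where 1: "\<epsilon>' > 0" "0 < \<mu>'" "\<mu>' < 1"
      "Vplus \<F> \<epsilon>' \<mu>' O Vplus \<F> \<epsilon>' \<mu>' \<subseteq> Vplus \<F> \<epsilon> \<mu>"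
    using Vplus_relcomp[OF len F F' em(1,2)] .
  have "open (Vplus \<F> \<epsilon>' \<mu>')" using F 1(1) by (rule open_Vplus)
  moreover have "\<nu> (Vplus \<F> \<epsilon>' \<mu>') = 1"
    unfolding \<nu> flow_ofilter_eq_1_iff[OF calculation] using 1 by blast
  ultimately show "\<exists>E. open E \<and> \<nu> E = 1 \<and> E O E \<subseteq> D" using 1(4) em(3) by blast
qed

section \<open>Transport of flows by bi-Lipschitz bijections\<close>

definition conjugate_flow :: "('a \<Rightarrow> 'b) \<Rightarrow> 'a flow \<Rightarrow> 'b flow" where
  "conjugate_flow f \<F> =
     Flow (start_time \<F>) (end_time \<F>) (\<lambda>t. f \<circ> flow_map \<F> t \<circ> inv f)"

lemma time_domain_conjugate_flow [simp]: "time_domain (conjugate_flow f \<F>) = time_domain \<F>"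
  by (simp add: conjugate_flow_def time_domain_def)

lemma flow_map_conjugate_flow:
  "bij f \<Longrightarrow> flow_map (conjugate_flow f \<F>) t (f x) = f (flow_map \<F> t x)"
  by (simp add: conjugate_flow_def bij_is_inj)

lemma reverse_conjugate_flow: "reverse_flow (conjugate_flow f \<F>) = conjugate_flow f (reverse_flow \<F>)"
  by (simp add: reverse_flow_def conjugate_flow_def)

text \<open>
  One constant \<open>L \<ge> 1\<close> bounds both distortions, so the inverse map is an instance with the same \<open>L\<close>,
  and each statement about \<open>f\<close> gives its converse.
\<close>

locale bi_Lipschitz_bijection =
  fixes f :: "'a::metric_space \<Rightarrow> 'b::metric_space" and L :: real
  assumes bij: "bij f" and L: "L \<ge> 1"
    and upper: "dist (f x) (f y) \<le> L * dist x y"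
    and lower: "dist x y \<le> L * dist (f x) (f y)"
begin

lemma Vplus_conjugate_flow:
  assumes V: "(x, y) \<in> Vplus \<F> \<epsilon> \<mu>" and T: "0 \<in> time_domain \<F>" and e: "\<epsilon> > 0" and m: "\<mu> \<ge> 0"
  shows "(f x, f y) \<in> Vplus (conjugate_flow f \<F>) \<epsilon> (L\<^sup>2 * \<mu>)"
proof -
  obtain s where s: "s \<in> {0..\<epsilon>} \<inter> time_domain \<F>" "dist y (flow_map \<F> s x) < \<mu> * dist x y"
    using V mem_Vplus_iff[OF T e] by blast
  have "dist (f y) (flow_map (conjugate_flow f \<F>) s (f x)) \<le> L * dist y (flow_map \<F> s x)"
    by (simp add: flow_map_conjugate_flow bij upper)
  also have "\<dots> < L * (\<mu> * dist x y)" using s(2) L by simp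
  also have "\<dots> \<le> L * (\<mu> * (L * dist (f x) (f y)))"
    using L m lower by (intro mult_left_mono) auto
  also have "\<dots> = L\<^sup>2 * \<mu> * dist (f x) (f y)" by (simp add: power2_eq_square)
  finally show ?thesis using s(1) T e by (subst mem_Vplus_iff) auto
qed

text \<open>
  Conjugation changes distances by a factor at most \<open>L\<close> before and after \<open>g\<close>; points closer than
  \<open>e / L\<close> come from points closer than \<open>e\<close>.
\<close>

lemma small_scale_upper_conjugate:
  assumes g: "small_scale_upper g c" and c: "c > 0"
  shows "small_scale_upper (f \<circ> g \<circ> inv f) (L\<^sup>2 * c)"
  unfolding small_scale_upper_def
proof (intro allI impI)
  fix K assume K: "L\<^sup>2 * c < K"
  then have "c < K / L\<^sup>2" using L by (simp add: field_simps)
  then obtain e where e: "e > 0" "\<And>u v. dist u v < e \<Longrightarrow> dist (g u) (g v) \<le> K / L\<^sup>2 * dist u v"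
    using g unfolding small_scale_upper_def by blast
  have K0: "K \<ge> 0" using K c L by (smt (verit) mult_nonneg_nonneg zero_le_power2)
  have "dist ((f \<circ> g \<circ> inv f) x) ((f \<circ> g \<circ> inv f) y) \<le> K * dist x y" if d: "dist x y < e / L" for x y
  proof -
    obtain u v where uv: "x = f u" "y = f v" using bij by (meson bij_pointE)
    have "dist u v < e" using lower[of u v] d uv L by (simp add: field_simps)
    have "dist (f (g u)) (f (g v)) \<le> L * dist (g u) (g v)" by (rule upper)
    also have "\<dots> \<le> L * (K / L\<^sup>2 * dist u v)"
      using e(2)[OF \<open>dist u v < e\<close>] L by (intro mult_left_mono) auto
    also have "\<dots> \<le> L * (K / L\<^sup>2 * (L * dist (f u) (f v)))"
      using L K0 lower by (intro mult_left_mono) auto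
    also have "\<dots> = K * dist (f u) (f v)" using L by (simp add: power2_eq_square)
    finally show ?thesis by (simp add: uv bij_is_inj[OF bij])
  qed
  then show "\<exists>e>0. \<forall>x y. dist x y < e \<longrightarrow>
      dist ((f \<circ> g \<circ> inv f) x) ((f \<circ> g \<circ> inv f) y) \<le> K * dist x y"
    using e(1) L by (intro exI[of _ "e / L"]) auto
qed

lemma small_scale_lower_conjugate:
  assumes g: "small_scale_lower g c"
  shows "small_scale_lower (f \<circ> g \<circ> inv f) (c / L\<^sup>2)"
  unfolding small_scale_lower_def
proof (intro allI impI)
  fix k assume k: "k < c / L\<^sup>2"
  show "\<exists>e>0. \<forall>x y. dist x y < e \<longrightarrow>
      k * dist x y \<le> dist ((f \<circ> g \<circ> inv f) x) ((f \<circ> g \<circ> inv f) y)"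
  \<comment> \<open>For negative \<open>k\<close> the bound is trivial; for the others \<open>upper\<close> may be multiplied by \<open>k\<close>.\<close>
  proof (cases "k \<ge> 0")
    case True
    have "L\<^sup>2 * k < c" using k L by (simp add: field_simps)
    then obtain e where e: "e > 0" "\<And>u v. dist u v < e \<Longrightarrow> L\<^sup>2 * k * dist u v \<le> dist (g u) (g v)"
      using g unfolding small_scale_lower_def by blast
    have "k * dist x y \<le> dist ((f \<circ> g \<circ> inv f) x) ((f \<circ> g \<circ> inv f) y)" if d: "dist x y < e / L" for x y
    proof -
      obtain u v where uv: "x = f u" "y = f v" using bij by (meson bij_pointE)
      have "dist u v < e" using lower[of u v] d uv L by (simp add: field_simps)
      have "L * (k * dist (f u) (f v)) \<le> L * (k * (L * dist u v))"
        using L True upper by (intro mult_left_mono) auto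
      also have "\<dots> = L\<^sup>2 * k * dist u v" by (simp add: power2_eq_square)
      also have "\<dots> \<le> dist (g u) (g v)" using e(2)[OF \<open>dist u v < e\<close>] .
      also have "\<dots> \<le> L * dist (f (g u)) (f (g v))" by (rule lower)
      finally have "k * dist (f u) (f v) \<le> dist (f (g u)) (f (g v))" using L by simp
      then show ?thesis by (simp add: uv bij_is_inj[OF bij])
    qed
    then show ?thesis using e(1) L by (intro exI[of _ "e / L"]) auto
  next
    case False
    then have "k * dist x y \<le> dist ((f \<circ> g \<circ> inv f) x) ((f \<circ> g \<circ> inv f) y)" for x y
      by (smt (verit) mult_nonneg_nonpos2 zero_le_dist mult.commute)
    then show ?thesis by (intro exI[of _ 1]) auto
  qed
qed

lemma bi_Lipschitz_bijection_inv: "bi_Lipschitz_bijection (inv f) L"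
proof
  fix x y
  obtain u v where "x = f u" "y = f v" using bij by (meson bij_pointE)
  then show "dist (inv f x) (inv f y) \<le> L * dist x y" "dist x y \<le> L * dist (inv f x) (inv f y)"
    using upper lower by (simp_all add: bij_is_inj[OF bij])
qed (use bij L in \<open>auto intro: bij_imp_bij_inv\<close>)

lemma conjugate_flow_inverse: "conjugate_flow (inv f) (conjugate_flow f \<F>) = \<F>"
  using bij by (cases \<F>) (simp add: conjugate_flow_def fun_eq_iff inv_inv_eq bij_is_inj)

lemma Vplus_conjugate_flow_inverse:
  assumes V: "(x, y) \<in> Vplus (conjugate_flow f \<F>) \<epsilon> \<mu>"
    and "0 \<in> time_domain \<F>" "\<epsilon> > 0" "\<mu> \<ge> 0"
  shows "(inv f x, inv f y) \<in> Vplus \<F> \<epsilon> (L\<^sup>2 * \<mu>)"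
  using bi_Lipschitz_bijection.Vplus_conjugate_flow[OF bi_Lipschitz_bijection_inv V] assms(2-)
  by (simp add: conjugate_flow_inverse)

text \<open>
  Pulled back by \<open>f\<close>, a cone of aperture below \<open>m0 / L\<^sup>2\<close> lies in one of aperture below \<open>m0\<close>, so
  the estimate for the original flow applies; transferring it back costs another factor \<open>L\<^sup>2\<close> in the constant.
\<close>

lemma transverse_conjugate_flow:
  assumes tr: "transverse_flow \<F>" and T: "0 \<in> time_domain \<F>"
  shows "transverse_flow (conjugate_flow f \<F>)"
proof -
  obtain C e0 m0 where C: "C > 0" "e0 > 0" "0 < m0" "m0 < 1"
    and tr: "\<forall>e'\<in>{0<..<e0}. \<forall>e''\<in>{0<..<e0}. \<forall>m'\<in>{0<..<m0}. \<forall>m''\<in>{0<..<m0}. \<forall>x y z.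
       (y, z) \<in> Vplus \<F> e' m' \<and> (y, x) \<in> Vplus (reverse_flow \<F>) e'' m'' \<longrightarrow>
          dist x y + dist y z \<le> C * dist x z"
    using tr unfolding transverse_flow_def by auto
  have T': "0 \<in> time_domain (reverse_flow \<F>)" using T by (simp add: time_domain_reverse_flow)
  have L2: "1 \<le> L\<^sup>2" using L by (simp add: one_le_power)
  have "m0 / L\<^sup>2 \<le> m0 / 1" using C L2 by (intro divide_left_mono) auto
  with C have "m0 / L\<^sup>2 < 1" by linarith
  moreover have "0 < m0 / L\<^sup>2" using C L by simp
  ultimately have m0: "0 < m0 / L\<^sup>2" "m0 / L\<^sup>2 < 1" by auto
  have "dist x y + dist y z \<le> L\<^sup>2 * C * dist x z"
    if e: "e' \<in> {0<..<e0}" "e'' \<in> {0<..<e0}" and m: "m' \<in> {0<..<m0 / L\<^sup>2}" "m'' \<in> {0<..<m0 / L\<^sup>2}"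
      and V: "(y, z) \<in> Vplus (conjugate_flow f \<F>) e' m'"
        "(y, x) \<in> Vplus (reverse_flow (conjugate_flow f \<F>)) e'' m''" for e' e'' m' m'' x y z
  proof -
    obtain u v w where uvw: "x = f u" "y = f v" "z = f w" using bij by (meson bij_pointE)
    have "(v, w) \<in> Vplus \<F> e' (L\<^sup>2 * m')"
      using Vplus_conjugate_flow_inverse[OF V(1) T] e m by (simp add: uvw bij_is_inj[OF bij])
    moreover have "(v, u) \<in> Vplus (reverse_flow \<F>) e'' (L\<^sup>2 * m'')"
      using Vplus_conjugate_flow_inverse[OF V(2)[unfolded reverse_conjugate_flow] T'] e m
      by (simp add: uvw bij_is_inj[OF bij])
    moreover have "L\<^sup>2 * m' \<in> {0<..<m0}" "L\<^sup>2 * m'' \<in> {0<..<m0}"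
      using m L by (auto simp: field_simps)
    ultimately have "dist u v + dist v w \<le> C * dist u w" using tr e by blast
    then have "L * (dist u v + dist v w) \<le> L * (C * dist u w)" using L by simp
    also have "\<dots> \<le> L * (C * (L * dist x z))"
      using L C lower uvw by (intro mult_left_mono) auto
    finally show ?thesis
      using upper[of u v] upper[of v w] uvw by (simp add: power2_eq_square algebra_simps)
  qed
  moreover have "0 < L\<^sup>2 * C" using L C by simp
  ultimately show ?thesis
    unfolding transverse_flow_def
    using C(2) m0 by (intro exI[of _ "L\<^sup>2 * C"] conjI exI[of _ e0] bexI[of _ "m0 / L\<^sup>2"]) auto
qed

lemma conjugate_flow_Lipflow:
  assumes F: "\<F> \<in> Lipflow"
  shows "conjugate_flow f \<F> \<in> Lipflow"
  unfolding Lipflow_iff time_domain_conjugate_flow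
proof (intro conjI ballI allI impI)
  have ff: "f (inv f x) = x" "inv f (f u) = u" for x u
    using bij by (simp_all add: bij_is_surj surj_f_inv_f bij_is_inj)
  have fm: "flow_map (conjugate_flow f \<F>) t = f \<circ> flow_map \<F> t \<circ> inv f" for t
    by (simp add: conjugate_flow_def)
  show "start_time (conjugate_flow f \<F>) < 0" "0 < end_time (conjugate_flow f \<F>)"
    using F by (auto simp: Lipflow_iff conjugate_flow_def)
  show "flow_map (conjugate_flow f \<F>) 0 x = x" for x
    by (simp add: fm ff flow_map_0[OF F])
  show "transverse_flow (conjugate_flow f \<F>)"
    using F zero_in_time_domain[OF F] by (simp add: Lipflow_iff transverse_conjugate_flow)
  show "flow_map (conjugate_flow f \<F>) (s + t) x = flow_map (conjugate_flow f \<F>) s (flow_map (conjugate_flow f \<F>) t x)"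
    if "s \<in> time_domain \<F>" "t \<in> time_domain \<F>" "s + t \<in> time_domain \<F>" for s t x
    using flow_map_add[OF F that] by (simp add: fm ff)
  show "equicontinuous_on (time_domain \<F>) {\<lambda>t. flow_map (conjugate_flow f \<F>) t x | x. True}"
    unfolding equicontinuous_on_def
  proof (intro ballI allI impI)
    fix t and e :: real assume t: "t \<in> time_domain \<F>" and e: "e > 0"
    have eL: "e / L > 0" using e L by simp
    obtain \<delta> where \<delta>: "\<delta> > 0" "\<And>s x. s \<in> time_domain \<F> \<Longrightarrow> dist s t < \<delta> \<Longrightarrow>
        dist (flow_map \<F> s x) (flow_map \<F> t x) < e / L"
      by (rule flow_map_equicontinuous[OF F t eL], rule that) blast+
    have "dist (f (flow_map \<F> s x)) (f (flow_map \<F> t x)) < e"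
      if "s \<in> time_domain \<F>" "dist s t < \<delta>" for s x
      using \<delta>(2)[OF that, of x] upper[of "flow_map \<F> s x" "flow_map \<F> t x"] L
      by (simp add: field_simps)
    then show "\<exists>\<delta>>0. \<forall>g\<in>{\<lambda>t. flow_map (conjugate_flow f \<F>) t x | x. True}.
        \<forall>s\<in>time_domain \<F>. dist s t < \<delta> \<longrightarrow> dist (g s) (g t) < e"
      using \<delta>(1) by (intro exI[of _ \<delta>]) (auto simp: fm)
  qed
  obtain M :: "real \<Rightarrow> real" where M: "\<And>t. t \<in> time_domain \<F> \<Longrightarrow> M t > 0"
      "continuous (at 0 within time_domain \<F>) M"
      "\<And>t. t \<in> time_domain \<F> \<Longrightarrow> small_scale_upper (flow_map \<F> t) (M t)"
      "\<And>t. t \<in> time_domain \<F> \<Longrightarrow> small_scale_lower (flow_map \<F> t) (1 / M t)"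
    using F unfolding Lipflow_iff by blast
  have "small_scale_lower (f \<circ> flow_map \<F> t \<circ> inv f) (1 / (L\<^sup>2 * M t))" if "t \<in> time_domain \<F>" for t
    using small_scale_lower_conjugate[OF M(4)[OF that]] by (simp add: mult.commute)
  moreover have "continuous (at 0 within time_domain \<F>) (\<lambda>t. L\<^sup>2 * M t)"
    using M(2) by (intro continuous_intros)
  ultimately show "\<exists>M :: real \<Rightarrow> real. (\<forall>t\<in>time_domain \<F>. M t > 0) \<and>
        continuous (at 0 within time_domain \<F>) M \<and>
        (\<forall>t\<in>time_domain \<F>. small_scale_upper (flow_map (conjugate_flow f \<F>) t) (M t) \<and>
           small_scale_lower (flow_map (conjugate_flow f \<F>) t) (1 / M t))"
    using M(1,3) L by (intro exI[of _ "\<lambda>t. L\<^sup>2 * M t"])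
      (auto simp: fm intro!: small_scale_upper_conjugate)
qed

lemma uniformly_continuous: "uniformly_continuous_on UNIV f"
proof -
  have "L-lipschitz_on UNIV f"
    using upper L by (intro lipschitz_onI) auto
  then show ?thesis by (rule lipschitz_on_uniformly_continuous)
qed

text \<open>
  The distortion of cones by \<open>f\<close> and by its inverse is absorbed by shrinking the aperture from
  \<open>\<mu>\<close> to \<open>\<mu> / L\<^sup>2\<close>.
\<close>

lemma push_conjugate_flow_ofilter:
  assumes F: "\<F> \<in> Lipflow"
  shows "push_ofilter (map_prod f f) (flow_ofilter \<F>) = flow_ofilter (conjugate_flow f \<F>)"
proof (rule push_flow_ofilter)
  have c: "continuous_on UNIV f"
    by (intro uniformly_continuous_imp_continuous uniformly_continuous)
  have "continuous_on UNIV (\<lambda>p. (f (fst p), f (snd p)))"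
    by (intro continuous_intros continuous_on_compose2[OF c]) auto
  then show "continuous_on UNIV (map_prod f f)"
    by (simp add: map_prod_def case_prod_unfold)
  note T = zero_in_time_domain[OF F]
  fix \<epsilon> \<mu> :: real assume em: "\<epsilon> > 0" "0 < \<mu>" "\<mu> < 1"
  have "\<mu> / L\<^sup>2 \<le> \<mu> / 1" using em L by (intro divide_left_mono) (auto simp: one_le_power)
  with em have "\<mu> / L\<^sup>2 < 1" by linarith
  moreover have "0 < \<mu> / L\<^sup>2" using em L by simp
  ultimately have m': "0 < \<mu> / L\<^sup>2" "\<mu> / L\<^sup>2 < 1" by auto
  have Lm: "L\<^sup>2 * (\<mu> / L\<^sup>2) = \<mu>" using L by simp
  have "map_prod f f ` Vplus \<F> \<epsilon> (\<mu> / L\<^sup>2) \<subseteq> Vplus (conjugate_flow f \<F>) \<epsilon> \<mu>"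
    using Vplus_conjugate_flow[OF _ T em(1), of _ _ "\<mu> / L\<^sup>2"] m' Lm by auto
  then show "\<exists>\<epsilon>'>0. \<exists>\<mu>'>0. \<mu>' < 1 \<and> map_prod f f ` Vplus \<F> \<epsilon>' \<mu>' \<subseteq> Vplus (conjugate_flow f \<F>) \<epsilon> \<mu>"
    using em(1) m' by blast
  have "Vplus (conjugate_flow f \<F>) \<epsilon> (\<mu> / L\<^sup>2) \<subseteq> map_prod f f ` Vplus \<F> \<epsilon> \<mu>"
  proof clarify
    fix x y assume "(x, y) \<in> Vplus (conjugate_flow f \<F>) \<epsilon> (\<mu> / L\<^sup>2)"
    then have "(inv f x, inv f y) \<in> Vplus \<F> \<epsilon> \<mu>"
      using Vplus_conjugate_flow_inverse[OF _ T em(1), of x y "\<mu> / L\<^sup>2"] m' Lm by simp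
    then show "(x, y) \<in> map_prod f f ` Vplus \<F> \<epsilon> \<mu>"
      using bij by (intro image_eqI) (auto simp: bij_is_surj surj_f_inv_f)
  qed
  then show "\<exists>\<epsilon>'>0. \<exists>\<mu>'>0. \<mu>' < 1 \<and> Vplus (conjugate_flow f \<F>) \<epsilon>' \<mu>' \<subseteq> map_prod f f ` Vplus \<F> \<epsilon> \<mu>"
    using em(1) m' by blast
qed

end

lemma surj_bi_Lipschitz_bijection:
  assumes "surj f" "bi_Lipschitz f"
  obtains L where "bi_Lipschitz_bijection f L"
proof -
  obtain l where l: "l > 0" "\<And>x y. dist x y / l \<le> dist (f x) (f y)" "\<And>x y. dist (f x) (f y) \<le> l * dist x y"
    using assms(2) unfolding bi_Lipschitz_def by blast
  have low: "dist x y \<le> l * dist (f x) (f y)" for x y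
    using l(2)[of x y] l(1) by (simp add: field_simps)
  have le: "l * r \<le> max 1 l * r" if "r \<ge> 0" for r using that by (intro mult_right_mono) auto
  have "inj f"
  proof (rule injI)
    fix x y assume "f x = f y"
    then show "x = y" using low[of x y] by simp
  qed
  with assms(1) have "bi_Lipschitz_bijection f (max 1 l)"
    using \<open>inj f\<close> order_trans[OF l(3) le] order_trans[OF low le]
    by unfold_locales (auto simp: bij_def)
  then show thesis by (rule that)
qed

theorem theorem2p16:
  shows "(Lip2_space TYPE('a::metric_space) \<longrightarrow>
            uniform_refinement (flow_refinement :: ('a \<times> 'a) ofilter set)) \<and>
         (\<forall>f :: 'a \<Rightarrow> 'b::metric_space.
            Lip2_space TYPE('a) \<and> Lip2_space TYPE('b) \<and> surj f \<and> bi_Lipschitz f \<longrightarrow>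
            uniformly_topologically_derivable
              (flow_refinement :: ('a \<times> 'a) ofilter set)
              (flow_refinement :: ('b \<times> 'b) ofilter set) f)"
proof (intro conjI impI allI)
  show "uniform_refinement (flow_refinement :: ('a \<times> 'a) ofilter set)" if "Lip2_space TYPE('a)"
    using that by (simp add: Lip2_space_def uniform_refinement_flow_refinement)
next
  fix f :: "'a \<Rightarrow> 'b"
  assume a: "Lip2_space TYPE('a) \<and> Lip2_space TYPE('b) \<and> surj f \<and> bi_Lipschitz f"
  then obtain L where "bi_Lipschitz_bijection f L" using surj_bi_Lipschitz_bijection by blast
  then interpret bi_Lipschitz_bijection f L .
  have "push_ofilter (map_prod f f) \<nu> \<in> flow_refinement" if "\<nu> \<in> flow_refinement" for \<nu>
    using that push_conjugate_flow_ofilter conjugate_flow_Lipflow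
    unfolding flow_refinement_def by fastforce
  with a show "uniformly_topologically_derivable
      (flow_refinement :: ('a \<times> 'a) ofilter set) (flow_refinement :: ('b \<times> 'b) ofilter set) f"
    by (simp add: uniformly_topologically_derivable_def Lip2_space_def
        uniform_refinement_flow_refinement uniformly_continuous)
qed

end
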